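(* Let $\mathrm M$ be a loopless matroid of rank $r$ and let $F:\operatorname{Fl}_r\to\operatorname{Fl}(\mathrm M)$ be a flag decoration of the permutohedron $\Pi_r$. Then the induced collection of edges $\mathcal E(F)$ of $\Pi_r$ induces a fan coarsening $\Xi(F)$ of $\Sigma_r$; that is, there is a complete fan $\Xi(F)$ coarsening $\Sigma_r$ such that $\mathcal E(F)$ is exactly the collection of edges of $\Pi_r$ whose two endpoints correspond to maximal cones of $\Sigma_r$ that are merged (contained in a common maximal cone) in $\Xi(F)$.
   Context: **Permutohedra.** $\Pi_r=\sum_{i<j}[e_i,e_j]\subset\mathbb R^r$ is the permutohedron; its normal fan $\Sigma_r\subset\mathbb R^r/\mathbb R\boldsymbol 1$ (the permutohedral fan, cut out by the hyperplanes $x_i=x_j$) consists of the cones $C(\mathcal W)=\operatorname{cone}(e_{W^1},\dots,e_{W^{k-1}})+\mathbb R\boldsymbol 1$ for flags $\mathcal W:\varnothing\subset W^1\subset\dots\subset W^k=[r]$ (strict inclusions) of subsets of $[r]$, where $e_S=\sum_{s\in S}e_s$. $\operatorname{Fl}_r$ is the set of such flags, partially ordered by refinement; it is isomorphic to the face poset of $\Sigma_r$. Vertices of $\Pi_r$ correspond to full flags; edges correspond to flags missing exactly one set, i.e. to pairs $(\mathcal W,\mathcal W')$ of full flags differing in exactly one set. Fans may have nonzero lineality space; a complete fan $\Xi$ coarsens $\Sigma_r$ if every cone of $\Sigma_r$ is contained in a cone of $\Xi$. **Flag decorations.** For a loopless matroid $\mathrm M$ of rank $r$ on $\mathrm E$,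 $\operatorname{Fl}(\mathrm M)$ is the set of flags of flats $\varnothing\subset F^1\subset\dots\subset F^k=\mathrm E$ of $\mathrm M$, partially ordered by refinement. A flag decoration of $\Pi_r$ by flags of $\mathrm M$ is a map of posets $F:\operatorname{Fl}_r\to\operatorname{Fl}(\mathrm M)$ such that for any flag $\mathcal W:\varnothing\subset W^1\subset\dots\subset W^k=[r]$, the flag $F(\mathcal W):\varnothing\subset F(\mathcal W)^1\subset\dots\subset F(\mathcal W)^k=\mathrm E$ has the same rank shape as $\mathcal W$, i.e. $\operatorname{rk}_{\mathrm M}F(\mathcal W)^i=|W^i|$ for every $1\le i\le k$. Then $F(\mathcal W)^i$ depends only on the set $W^i$ and is denoted $F(W^i)$ (with $F(\varnothing)=\varnothing$). **The collection $\mathcal E(F)$.** An edge $(\mathcal W,\mathcal W')$ of $\Pi_r$ belongs to $\mathcal E(F)$ if there exists an ordered basis $B=(b_1,\dots,b_r)$ of $\mathrm M$ to which $F(\mathcal W)$ and $F(\mathcal W')$ are adapted simultaneously: for every $0\le i\le r$, $F(W^i)=\operatorname{cl}_{\mathrm M}(b_j\mid j\in W^i)$ and $F((W')^i)=\operatorname{cl}_{\mathrm M}(b_j\mid j\in(W')^i)$. *)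

theory Defs
  imports "HOL-Analysis.Analysis"
begin

section \<open>Matroids\<close>

locale matroid =
  fixes E :: "'a set" and indep :: "'a set \<Rightarrow> bool"
  assumes finite_ground: "finite E"
    and indep_subset_ground: "indep X \<Longrightarrow> X \<subseteq> E"
    and indep_empty: "indep {}"
    and indep_subset: "indep Y \<Longrightarrow> X \<subseteq> Y \<Longrightarrow> indep X"
    and augment: "indep X \<Longrightarrow> indep Y \<Longrightarrow> card X < card Y \<Longrightarrow>
                    \<exists>y\<in>Y - X. indep (insert y X)"
begin

definition rk :: "'a set \<Rightarrow> nat" where
  "rk X = Max {card I |I. I \<subseteq> X \<and> indep I}"

definition cl :: "'a set \<Rightarrow> 'a set" where
  "cl X = {x \<in> E. rk (insert x X) = rk X}"

definition flat :: "'a set \<Rightarrow> bool" where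
  "flat X \<longleftrightarrow> X \<subseteq> E \<and> cl X = X"

definition basis :: "'a set \<Rightarrow> bool" where
  "basis B \<longleftrightarrow> indep B \<and> (\<forall>I. indep I \<longrightarrow> B \<subseteq> I \<longrightarrow> I = B)"

definition loopless :: bool where
  "loopless \<longleftrightarrow> (\<forall>x\<in>E. indep {x})"

end


section \<open>Flags of subsets and the permutohedral fan\<close>

text \<open>
  The index set \<open>[r]\<close> is a finite type \<open>'n\<close> with \<open>CARD('n) = r\<close>, so that \<open>\<real>\<^sup>r\<close> is \<open>real ^ 'n\<close>.
  A flag \<open>\<emptyset> \<subset> W\<^sup>1 \<subset> \<dots> \<subset> W\<^sup>k = T\<close> is the list \<open>[W\<^sup>1, \<dots>, W\<^sup>k]\<close>; the leading \<open>\<emptyset>\<close> is not stored.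
  Hence \<open>W\<^sup>i = W ! (i - 1)\<close>, and \<open>({} # W) ! i\<close> is \<open>W\<^sup>i\<close> with the convention \<open>W\<^sup>0 = \<emptyset>\<close>.
\<close>

definition is_flag :: "'a set \<Rightarrow> 'a set list \<Rightarrow> bool" where
  "is_flag T W \<longleftrightarrow> sorted_wrt (\<subset>) ({} # W) \<and> last ({} # W) = T"

definition refines :: "'a set list \<Rightarrow> 'a set list \<Rightarrow> bool" where
  "refines W' W \<longleftrightarrow> set W \<subseteq> set W'"

definition Fl :: "'n::finite set list set" where
  "Fl = {W. is_flag UNIV W}"

definition full_flag :: "'n::finite set list \<Rightarrow> bool" where
  "full_flag W \<longleftrightarrow> W \<in> Fl \<and> length W = CARD('n)"

definition e :: "'n::finite set \<Rightarrow> real ^ 'n" where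
  "e S = (\<Sum>s\<in>S. axis s 1)"

text \<open>
  Cones of the fan in \<open>\<real>\<^sup>r/\<real>1\<close> are represented by their preimages in \<open>\<real>\<^sup>r\<close>,
  so all fans below may have lineality.
\<close>

definition flag_cone :: "'n::finite set list \<Rightarrow> (real ^ 'n) set" where
  "flag_cone W =
     {x + t *\<^sub>R e UNIV |x t. x \<in> convex_cone hull (e ` set (butlast W))}"

definition permutohedral_fan :: "(real ^ 'n::finite) set set" where
  "permutohedral_fan = flag_cone ` Fl"

text \<open>
  Vertices of the permutohedron are full flags, and its edges are pairs of full flags
  that differ in exactly one set. Edges are recorded as ordered pairs, each edge
  occurring with both orientations.
\<close>

definition permutohedron_edges :: "('n::finite set list \<times> 'n set list) set" where
  "permutohedron_edges =
     {(W, W'). full_flag W \<and> full_flag W' \<and> (\<exists>!i. i < CARD('n) \<and> W ! i \<noteq> W' ! i)}"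


section \<open>Fans\<close>

definition polyhedral_cone :: "'v::euclidean_space set \<Rightarrow> bool" where
  "polyhedral_cone C \<longleftrightarrow> polyhedron C \<and> convex_cone C"

text \<open>The relation \<open>face_of\<close> counts the empty set as a face, which a fan does not contain.\<close>

definition is_fan :: "'v::euclidean_space set set \<Rightarrow> bool" where
  "is_fan \<Xi> \<longleftrightarrow> finite \<Xi> \<and> \<Xi> \<noteq> {} \<and> (\<forall>C\<in>\<Xi>. polyhedral_cone C) \<and>
     (\<forall>C\<in>\<Xi>. \<forall>D. D face_of C \<longrightarrow> D \<noteq> {} \<longrightarrow> D \<in> \<Xi>) \<and>
     (\<forall>C\<in>\<Xi>. \<forall>D\<in>\<Xi>. C \<inter> D face_of C \<and> C \<inter> D face_of D)"

definition complete_fan :: "'v::euclidean_space set set \<Rightarrow> bool" where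
  "complete_fan \<Xi> \<longleftrightarrow> is_fan \<Xi> \<and> \<Union>\<Xi> = UNIV"

definition coarsens :: "'v::euclidean_space set set \<Rightarrow> 'v set set \<Rightarrow> bool" where
  "coarsens \<Xi> \<Sigma> \<longleftrightarrow> (\<forall>C\<in>\<Sigma>. \<exists>D\<in>\<Xi>. C \<subseteq> D)"

definition maximal_cone :: "'v::euclidean_space set set \<Rightarrow> 'v set \<Rightarrow> bool" where
  "maximal_cone \<Xi> C \<longleftrightarrow> C \<in> \<Xi> \<and> (\<forall>D\<in>\<Xi>. C \<subseteq> D \<longrightarrow> D = C)"

definition merged_in :: "'v::euclidean_space set set \<Rightarrow> 'v set \<Rightarrow> 'v set \<Rightarrow> bool" where
  "merged_in \<Xi> C C' \<longleftrightarrow> (\<exists>D. maximal_cone \<Xi> D \<and> C \<subseteq> D \<and> C' \<subseteq> D)"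


section \<open>Flag decorations of the permutohedron\<close>

context matroid
begin

definition flags_of_flats :: "'a set list set" where
  "flags_of_flats = {G. is_flag E G \<and> (\<forall>X\<in>set G. flat X)}"

text \<open>Only the values of \<open>F\<close> on \<open>Fl\<close> matter.\<close>

definition flag_decoration :: "('n::finite set list \<Rightarrow> 'a set list) \<Rightarrow> bool" where
  "flag_decoration F \<longleftrightarrow>
     (\<forall>W\<in>Fl. F W \<in> flags_of_flats) \<and>
     (\<forall>W\<in>Fl. \<forall>W'\<in>Fl. refines W' W \<longrightarrow> refines (F W') (F W)) \<and>
     (\<forall>W\<in>Fl. length (F W) = length W \<and> (\<forall>i<length W. rk (F W ! i) = card (W ! i)))"

definition ordered_basis :: "('n::finite \<Rightarrow> 'a) \<Rightarrow> bool" where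
  "ordered_basis b \<longleftrightarrow> inj b \<and> basis (range b)"

definition adapted ::
    "('n::finite set list \<Rightarrow> 'a set list) \<Rightarrow> ('n \<Rightarrow> 'a) \<Rightarrow> 'n set list \<Rightarrow> bool" where
  "adapted F b W \<longleftrightarrow> (\<forall>i\<le>CARD('n). ({} # F W) ! i = cl (b ` (({} # W) ! i)))"

definition edge_collection ::
    "('n::finite set list \<Rightarrow> 'a set list) \<Rightarrow> ('n set list \<times> 'n set list) set" where
  "edge_collection F =
     {(W, W') \<in> permutohedron_edges. \<exists>b. ordered_basis b \<and> adapted F b W \<and> adapted F b W'}"

end

end

theory Submission
  imports Defs
begin

text \<open>
  A flag decoration is a monotone family \<open>G S\<close> of flats with \<open>rk (G S) = card S\<close>. Call \<open>S\<close> and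
  \<open>T\<close> joined if \<open>G S \<union> G T\<close> has rank \<open>card (S \<union> T)\<close>; by submodularity \<open>G\<close> then also preserves their
  intersection. The sets joined to every member of a full chain \<open>C\<close> form a lattice \<open>compat C\<close> whose
  members are pairwise joined, so \<open>compat C' = compat C\<close> for every full chain \<open>C' \<subseteq> compat C\<close>, and
  there is one basis spanning \<open>G S\<close> by its \<open>S\<close>-part for all \<open>S \<in> compat C\<close>. Hence an edge
  lies in the collection iff its two chains have the same lattice. The vectors whose superlevel
  sets all lie in \<open>compat C\<close> form an order cone, and these cones are the maximal cones of the fan.

  Two such cones meet in a face because of a local exchange property: if \<open>A\<close> and \<open>A'\<close> are
  compatible with \<open>C'\<close>, while \<open>A \<inter> A'\<close> and \<open>A \<union> A'\<close> are compatible with \<open>C\<close>, then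
  \<open>A\<close> is compatible with \<open>C\<close>.
\<close>

section \<open>Rank and closure in matroids\<close>

context matroid
begin

lemma indep_finite: "indep I \<Longrightarrow> finite I"
  using finite_ground finite_subset indep_subset_ground by blast

lemma finite_indep_cards: "finite {card I |I. I \<subseteq> X \<and> indep I}"
proof -
  have "{card I |I. I \<subseteq> X \<and> indep I} \<subseteq> card ` Pow E"
    using indep_subset_ground by auto
  then show ?thesis
    using finite_ground finite_subset by blast
qed

lemma indep_card_le_rk: "I \<subseteq> X \<Longrightarrow> indep I \<Longrightarrow> card I \<le> rk X"
  unfolding rk_def by (rule Max_ge[OF finite_indep_cards]) blast

lemma rk_attained: "\<exists>I\<subseteq>X. indep I \<and> card I = rk X"
proof -
  have "{card I |I. I \<subseteq> X \<and> indep I} \<noteq> {}"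
    using indep_empty by blast
  from Max_in[OF finite_indep_cards this] show ?thesis
    unfolding rk_def by auto
qed

lemma rk_mono: "X \<subseteq> Y \<Longrightarrow> rk X \<le> rk Y"
  by (metis indep_card_le_rk rk_attained subset_trans)

lemma rk_le_card: "finite X \<Longrightarrow> rk X \<le> card X"
  by (metis card_mono rk_attained)

lemma rk_indep: "indep I \<Longrightarrow> rk I = card I"
  by (simp add: indep_card_le_rk indep_finite le_antisym rk_le_card)

lemma indep_if_rk_eq_card:
  assumes "finite X" "rk X = card X" shows "indep X"
  by (metis assms card_subset_eq rk_attained)

lemma indep_extend:
  assumes "indep I" "I \<subseteq> X"
  shows "\<exists>J. I \<subseteq> J \<and> J \<subseteq> X \<and> indep J \<and> card J = rk X"
  using assms
proof (induction "rk X - card I" arbitrary: I)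
  case 0
  then show ?case
    using indep_card_le_rk by (metis diff_is_0_eq le_antisym order_refl)
next
  case (Suc n)
  obtain K where K: "K \<subseteq> X" "indep K" "card K = rk X"
    using rk_attained by blast
  then obtain y where y: "y \<in> K - I" "indep (insert y I)"
    using augment[of I K] Suc.hyps(2) Suc.prems(1) by fastforce
  have "card (insert y I) = Suc (card I)"
    using y Suc.prems(1) indep_finite by auto
  then have "n = rk X - card (insert y I)"
    using Suc.hyps(2) by linarith
  from Suc.hyps(1)[OF this y(2)] K y Suc.prems show ?case
    by blast
qed

text \<open>Extend a maximal independent set \<open>I\<close> of the intersection to a maximal
  independent set \<open>J\<close> of the union. The traces of \<open>J\<close> on \<open>X\<close>
  and \<open>Y\<close> are independent, cover \<open>J\<close> and both contain
  \<open>I\<close>.\<close>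

lemma rk_submodular: "rk (X \<union> Y) + rk (X \<inter> Y) \<le> rk X + rk Y"
proof -
  obtain I where I: "I \<subseteq> X \<inter> Y" "indep I" "card I = rk (X \<inter> Y)"
    using rk_attained by blast
  then obtain J where J: "I \<subseteq> J" "J \<subseteq> X \<union> Y" "indep J" "card J = rk (X \<union> Y)"
    using indep_extend[of I "X \<union> Y"] by blast
  have fin: "finite J"
    using J indep_finite by blast
  have "card J + card I \<le> card ((J \<inter> X) \<union> (J \<inter> Y)) + card ((J \<inter> X) \<inter> (J \<inter> Y))"
    using I J fin by (intro add_mono card_mono) auto
  also have "\<dots> = card (J \<inter> X) + card (J \<inter> Y)"
    using fin card_Un_Int[of "J \<inter> X" "J \<inter> Y"] by simp
  also have "\<dots> \<le> rk X + rk Y"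
    using J indep_subset by (intro add_mono indep_card_le_rk) auto
  finally show ?thesis
    using I J by simp
qed

lemma rk_Un_absorb:
  assumes "X \<subseteq> Y" "rk X = rk Y" shows "rk (Y \<union> Z) = rk (X \<union> Z)"
proof -
  have "rk ((X \<union> Z) \<union> Y) + rk ((X \<union> Z) \<inter> Y) \<le> rk (X \<union> Z) + rk Y"
    by (rule rk_submodular)
  moreover have "rk X \<le> rk ((X \<union> Z) \<inter> Y)" "rk (X \<union> Z) \<le> rk (Y \<union> Z)"
    using assms(1) by (blast intro: rk_mono)+
  moreover have "(X \<union> Z) \<union> Y = Y \<union> Z"
    using assms by blast
  ultimately show ?thesis
    using assms by simp
qed

text \<open>An element that does not raise the rank of \<open>X\<close> does not raise the rank of
  the larger set \<open>Z\<close>, by submodularity, so it lies in the flat \<open>Z\<close>. This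
  turns equalities of ranks into inclusions of flats.\<close>

lemma flat_absorb:
  assumes "flat Z" "X \<subseteq> Z" "Y \<subseteq> E" "rk (X \<union> Y) = rk X"
  shows "Y \<subseteq> Z"
proof
  fix y assume y: "y \<in> Y"
  have "rk X \<le> rk (insert y X)" "rk (insert y X) \<le> rk (X \<union> Y)"
    using y by (blast intro: rk_mono)+
  then have "rk (insert y X \<union> Z) = rk (X \<union> Z)"
    using assms rk_Un_absorb[of X "insert y X" Z] by auto
  moreover have "insert y X \<union> Z = insert y Z" "X \<union> Z = Z"
    using assms by auto
  ultimately show "y \<in> Z"
    using assms y unfolding flat_def cl_def by auto
qed

lemma cl_eq_flat:
  assumes "flat Z" "X \<subseteq> Z" "rk X = rk Z" shows "cl X = Z"
proof
  show "cl X \<subseteq> Z"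
  proof
    fix x assume "x \<in> cl X"
    then have "{x} \<subseteq> Z"
      by (intro flat_absorb[OF assms(1,2), of "{x}"]) (auto simp: cl_def)
    then show "x \<in> Z" by simp
  qed
  show "Z \<subseteq> cl X"
  proof
    fix y assume y: "y \<in> Z"
    have "rk X \<le> rk (insert y X)" "rk (insert y X) \<le> rk Z"
      using y assms(2) by (blast intro: rk_mono)+
    then show "y \<in> cl X"
      using assms y unfolding cl_def flat_def by auto
  qed
qed

lemma subset_cl: "X \<subseteq> E \<Longrightarrow> X \<subseteq> cl X"
  by (auto simp: cl_def insert_absorb)

lemma flat_ground: "flat E"
  by (auto simp: flat_def cl_def insert_absorb)

lemma flat_empty: "loopless \<Longrightarrow> flat {}"
  using rk_indep[OF indep_empty] rk_indep
  by (fastforce simp: flat_def cl_def loopless_def)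

end


section \<open>Sets compatible with a full chain\<close>

text \<open>The case \<open>k = 0\<close> forces the empty set into the chain, whereas flags do not
  store it. The chain of a flag \<open>W\<close> is therefore
  \<open>insert {} (set W)\<close>.\<close>

definition full_chain :: "'n::finite set set \<Rightarrow> bool" where
  "full_chain C \<longleftrightarrow> (\<forall>S\<in>C. \<forall>T\<in>C. S \<subseteq> T \<or> T \<subseteq> S) \<and> (\<forall>k\<le>CARD('n). \<exists>S\<in>C. card S = k)"

lemma full_chain_comparable:
  "full_chain C \<Longrightarrow> S \<in> C \<Longrightarrow> T \<in> C \<Longrightarrow> S \<subseteq> T \<or> T \<subseteq> S"
  by (simp add: full_chain_def)

lemma full_chain_card:
  "full_chain (C :: 'n::finite set set) \<Longrightarrow> k \<le> CARD('n) \<Longrightarrow> \<exists>S\<in>C. card S = k"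
  by (simp add: full_chain_def)

lemma UNIV_mem_full_chain: "full_chain C \<Longrightarrow> UNIV \<in> C"
  using full_chain_card by (metis card_eq_UNIV_imp_eq_UNIV finite order_refl)

text \<open>\<open>card\<close> is injective on a chain of finite sets, and here there are as many
  members as possible cardinalities, so each cardinality occurs.\<close>

lemma full_flag_full_chain:
  fixes W :: "'n::finite set list"
  assumes "full_flag W"
  shows "full_chain (insert {} (set W))"
proof -
  define V where "V = {} # W"
  have V: "sorted_wrt (\<subset>) V" "length V = Suc CARD('n)"
    using assms by (auto simp: V_def full_flag_def Fl_def is_flag_def)
  have lt: "V ! i \<subset> V ! j" if "i < j" "j < length V" for i j
    using V(1) that by (simp add: sorted_wrt_iff_nth_less)
  have cmp: "S \<subseteq> T \<or> T \<subseteq> S" if "S \<in> set V" "T \<in> set V" for S T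
    using that lt by (metis in_set_conv_nth linorder_neqE_nat order_refl psubset_imp_subset)
  have inj: "inj_on card (set V)"
    by (intro inj_onI) (metis card_subset_eq cmp finite)
  have "distinct V"
    unfolding distinct_conv_nth using lt by (metis linorder_neqE_nat psubset_eq)
  then have "card (card ` set V) = card {..CARD('n)}"
    using V(2) inj by (simp add: card_image distinct_card)
  moreover have "card ` set V \<subseteq> {..CARD('n)}"
    by (auto intro: card_mono)
  ultimately have "card ` set V = {..CARD('n)}"
    by (intro card_subset_eq) auto
  then have "\<exists>S\<in>set V. card S = k" if "k \<le> CARD('n)" for k
    using that by (metis atMost_iff imageE)
  with cmp show ?thesis
    by (simp add: full_chain_def V_def)
qed

text \<open>Order the elements by the number \<open>f i\<close> of members of \<open>K\<close> that
  miss \<open>i\<close>. Elements inside a member of \<open>K\<close> have smaller values than those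
  outside, so each member of \<open>K\<close> is an initial segment of the ordering.\<close>

lemma chain_extends_to_full_flag:
  fixes K :: "'n::finite set set"
  assumes chain: "\<And>S T. S \<in> K \<Longrightarrow> T \<in> K \<Longrightarrow> S \<subseteq> T \<or> T \<subseteq> S"
  shows "\<exists>W. full_flag W \<and> K \<subseteq> insert {} (set W)"
proof -
  define f where "f i = card {S\<in>K. i \<notin> S}" for i
  obtain xs :: "'n list" where xs: "set xs = UNIV" "distinct xs"
    using finite_distinct_list[OF finite[of UNIV]] by blast
  define l where "l = sort_key f xs"
  have l: "set l = UNIV" "distinct l" "sorted (map f l)"
    by (simp_all add: l_def xs)
  then have len: "length l = CARD('n)"
    by (metis distinct_card)
  define W where "W = map (\<lambda>k. set (take (Suc k) l)) [0..<CARD('n)]"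
  have V: "{} # W = map (\<lambda>k. set (take k l)) [0..<Suc CARD('n)]"
    unfolding W_def by (simp only: upt_conv_Cons[OF zero_less_Suc] map_Suc_upt[symmetric]) simp
  have "set (take i l) \<subset> set (take j l)" if "i < j" "j \<le> CARD('n)" for i j
  proof (rule psubsetI)
    show "set (take i l) \<subseteq> set (take j l)"
      using that by (intro set_take_subset_set_take) simp
    have "card (set (take i l)) = i" "card (set (take j l)) = j"
      using that len l(2) by (simp_all add: distinct_card)
    then show "set (take i l) \<noteq> set (take j l)"
      using that by auto
  qed
  then have "sorted_wrt (\<subset>) ({} # W)"
    unfolding V by (auto simp: sorted_wrt_iff_nth_less simp del: upt_Suc)
  moreover have "last ({} # W) = UNIV"
    unfolding V by (simp add: l len)
  ultimately have "full_flag W"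
    by (simp add: full_flag_def Fl_def is_flag_def W_def)
  moreover have "S \<in> set ({} # W)" if S: "S \<in> K" for S
  proof -
    have less: "f i < f j" if "i \<in> S" "j \<notin> S" for i j
      unfolding f_def
    proof (rule psubset_card_mono)
      show "{T \<in> K. i \<notin> T} \<subset> {T \<in> K. j \<notin> T}"
        using chain[OF S] S that by blast
    qed simp
    define ys zs where "ys = takeWhile (\<lambda>i. i \<in> S) l" and "zs = dropWhile (\<lambda>i. i \<in> S) l"
    have yz: "l = ys @ zs"
      by (simp add: ys_def zs_def)
    have "set zs \<inter> S = {}"
    proof (cases zs)
      case (Cons z zs')
      then have "z \<notin> S"
        by (metis hd_dropWhile list.distinct(1) list.sel(1) zs_def)
      moreover have "\<forall>i\<in>set zs. f z \<le> f i"
        using l(3) yz Cons by (auto simp: sorted_append)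
      ultimately show ?thesis
        using less by (meson disjoint_iff not_less)
    qed simp
    moreover have "set ys \<subseteq> S"
      unfolding ys_def using set_takeWhileD by fast
    ultimately have "S = set (take (length ys) l)"
      using yz l(1) by auto
    moreover have "length ys \<in> set [0..<Suc CARD('n)]"
      using yz len by auto
    ultimately show ?thesis
      unfolding V by (simp only: set_map) blast
  qed
  ultimately show ?thesis
    by (intro exI[of _ W]) auto
qed

section \<open>Monotone families of flats and joined pairs\<close>

locale flat_family = matroid E indep
  for E :: "'a set" and indep :: "'a set \<Rightarrow> bool" +
  fixes G :: "'n::finite set \<Rightarrow> 'a set"
  assumes flat_G: "flat (G S)"
    and rk_G: "rk (G S) = card S"
    and mono_G: "S \<subseteq> T \<Longrightarrow> G S \<subseteq> G T"
begin

text \<open>Both flats lie in \<open>G (S \<union> T)\<close>, which has rank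
  \<open>card (S \<union> T)\<close>. The condition thus says that together they span it.\<close>

definition joins :: "'n set \<Rightarrow> 'n set \<Rightarrow> bool" where
  "joins S T \<longleftrightarrow> rk (G S \<union> G T) = card (S \<union> T)"

lemma G_ground: "G S \<subseteq> E"
  using flat_G flat_def by blast

lemma rk_G_Un_le: "rk (G S \<union> G T) \<le> card (S \<union> T)"
  by (metis Un_least mono_G rk_G rk_mono sup_ge1 sup_ge2)

lemma joinsI: "card (S \<union> T) \<le> rk (G S \<union> G T) \<Longrightarrow> joins S T"
  by (simp add: joins_def le_antisym rk_G_Un_le)

lemma joins_sym: "joins S T \<Longrightarrow> joins T S"
  by (simp add: joins_def Un_commute)

lemma joins_comparable: "S \<subseteq> T \<Longrightarrow> joins S T"
  by (simp add: joins_def mono_G rk_G Un_absorb1)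

text \<open>Submodularity bounds the rank of \<open>G S \<inter> G T\<close> by
  \<open>card (S \<inter> T)\<close>, which is already the rank of the flat
  \<open>G (S \<inter> T)\<close> inside it.\<close>

lemma G_Int:
  assumes "joins S T" shows "G (S \<inter> T) = G S \<inter> G T"
proof -
  have sub: "G (S \<inter> T) \<subseteq> G S \<inter> G T"
    by (simp add: mono_G)
  have "rk (G S \<union> G T) + rk (G S \<inter> G T) \<le> rk (G S) + rk (G T)"
    by (rule rk_submodular)
  then have "rk (G S \<inter> G T) \<le> card (S \<inter> T)"
    using assms card_Un_Int[of S T] by (simp add: joins_def rk_G)
  moreover have "card (S \<inter> T) \<le> rk (G S \<inter> G T)"
    using rk_mono[OF sub] by (simp add: rk_G)
  ultimately have "rk (G (S \<inter> T) \<union> (G S \<inter> G T)) = rk (G (S \<inter> T))"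
    using sub by (simp add: Un_absorb1 rk_G)
  then have "G S \<inter> G T \<subseteq> G (S \<inter> T)"
    using flat_absorb[OF flat_G order_refl] G_ground by blast
  with sub show ?thesis by blast
qed

text \<open>Only elements outside \<open>T\<close> are removed, so
  \<open>card (S \<union> T)\<close> drops by \<open>card (S - S')\<close>. By submodularity the
  rank of the union drops by at most the same amount.\<close>

lemma joins_shrink:
  assumes "joins S T" "S \<inter> T \<subseteq> S'" "S' \<subseteq> S"
  shows "joins S' T"
proof (rule joinsI)
  have "rk ((G S' \<union> G T) \<union> G S) + rk ((G S' \<union> G T) \<inter> G S) \<le> rk (G S' \<union> G T) + rk (G S)"
    by (rule rk_submodular)
  moreover have "(G S' \<union> G T) \<union> G S = G S \<union> G T"
    using mono_G[OF assms(3)] by blast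
  moreover have "card S' \<le> rk ((G S' \<union> G T) \<inter> G S)"
    using rk_mono[of "G S'" "(G S' \<union> G T) \<inter> G S"] mono_G[OF assms(3)] by (simp add: rk_G)
  ultimately have 1: "card (S \<union> T) + card S' \<le> rk (G S' \<union> G T) + card S"
    using assms(1) by (simp add: joins_def rk_G)
  have "card (S \<union> T) = card (S' \<union> T) + card (S - S')"
    using assms(2,3) by (subst card_Un_disjoint[symmetric]) (auto intro: arg_cong[where f=card])
  moreover have "card S = card S' + card (S - S')"
    using assms(3) by (metis card_Diff_subset card_mono finite le_add_diff_inverse)
  ultimately show "card (S' \<union> T) \<le> rk (G S' \<union> G T)"
    using 1 by linarith
qed

text \<open>If the rank did not exceed that of \<open>G X \<union> G Y\<close>, the set
  \<open>A\<close> would be absorbed by the flat \<open>G (X \<union> Y)\<close>. This supplies the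
  one extra unit of rank when a single element is added.\<close>

lemma card_Un_less_rk:
  assumes "joins X Y" "\<not> A \<subseteq> G (X \<union> Y)" "G X \<subseteq> A" "A \<subseteq> E"
  shows "card (X \<union> Y) < rk (A \<union> G Y)"
proof (rule ccontr)
  assume *: "\<not> card (X \<union> Y) < rk (A \<union> G Y)"
  have "rk (G X \<union> G Y) \<le> rk (A \<union> G Y)"
    using assms(3) by (intro rk_mono) blast
  moreover have "(G X \<union> G Y) \<union> A = A \<union> G Y"
    using assms(3) by blast
  ultimately have "rk ((G X \<union> G Y) \<union> A) = rk (G X \<union> G Y)"
    using * assms(1) by (simp add: joins_def)
  then have "A \<subseteq> G (X \<union> Y)"
    using flat_absorb[OF flat_G, of "G X \<union> G Y" "X \<union> Y" A] assms(4) mono_G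
    by (metis Un_least sup_ge1 sup_ge2)
  with assms(2) show False by blast
qed

section \<open>The lattice of compatible sets\<close>

definition compat :: "'n set set \<Rightarrow> 'n set set" where
  "compat C = {S. \<forall>T\<in>C. joins S T}"

lemma chain_subset_compat: "full_chain C \<Longrightarrow> C \<subseteq> compat C"
  unfolding full_chain_def compat_def
  by (intro subsetI CollectI ballI) (meson joins_comparable joins_sym)

lemma empty_mem_compat: "{} \<in> compat C"
  by (simp add: compat_def joins_comparable)

lemma UNIV_mem_compat: "UNIV \<in> compat C"
  by (simp add: compat_def joins_comparable joins_sym)

text \<open>For chain members inside \<open>P\<close>, passing from \<open>S\<close> to
  \<open>S \<inter> P\<close> keeps the intersection with them, so \<open>joins_shrink\<close>
  applies. The other members contain \<open>P\<close>.\<close>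

lemma compat_Int_chain:
  assumes "full_chain C" "S \<in> compat C" "P \<in> C"
  shows "S \<inter> P \<in> compat C"
proof -
  have "joins (S \<inter> P) T" if T: "T \<in> C" for T
  proof (cases "T \<subseteq> P")
    case True
    then show ?thesis
      using assms(2) T by (intro joins_shrink[of S T "S \<inter> P"]) (auto simp: compat_def)
  next
    case False
    then have "P \<subseteq> T"
      using full_chain_comparable[OF assms(1,3) T] by blast
    then show ?thesis
      by (intro joins_comparable) blast
  qed
  then show ?thesis by (simp add: compat_def)
qed

text \<open>\<open>Q\<close> and \<open>insert i Q\<close> are consecutive in the chain. Against
  members inside \<open>Q\<close>, the set \<open>S\<close> gains only the element \<open>i\<close>
  over \<open>S \<inter> Q\<close>, and since \<open>G S\<close> leaves \<open>G Q\<close> the rank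
  grows by at least one. The remaining members contain \<open>S\<close>.\<close>

lemma compat_step:
  assumes C: "full_chain C" and Q: "Q \<in> C" and P: "insert i Q \<in> C" and "i \<notin> Q" "i \<in> S"
    and S: "S \<subseteq> insert i Q" and SQ: "S \<inter> Q \<in> compat C" and G: "\<not> G S \<subseteq> G Q"
  shows "S \<in> compat C"
proof -
  have "joins S T" if T: "T \<in> C" for T
  proof (cases "T \<subseteq> Q")
    case True
    have "\<not> G S \<subseteq> G ((S \<inter> Q) \<union> T)"
      using G mono_G[of "(S \<inter> Q) \<union> T" Q] True by blast
    then have "card ((S \<inter> Q) \<union> T) < rk (G S \<union> G T)"
      using SQ T G_ground by (intro card_Un_less_rk) (auto simp: compat_def mono_G)
    moreover have "S \<union> T = insert i ((S \<inter> Q) \<union> T)"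
      using S \<open>i \<in> S\<close> True by blast
    then have "card (S \<union> T) \<le> Suc (card ((S \<inter> Q) \<union> T))"
      by (metis card_insert_le_m1 card_insert_if finite le_Suc_eq order_refl)
    ultimately show ?thesis
      by (intro joinsI) linarith
  next
    case False
    then have "Q \<subset> T"
      using full_chain_comparable[OF C Q T] by blast
    moreover have "T \<subseteq> insert i Q \<or> insert i Q \<subseteq> T"
      by (rule full_chain_comparable[OF C T P])
    ultimately have "insert i Q \<subseteq> T"
      by blast
    then show ?thesis
      using S by (intro joins_comparable) blast
  qed
  then show ?thesis by (simp add: compat_def)
qed

text \<open>Induction along the chain, with \<open>P\<close> a member bounding both sets;
  \<open>P = UNIV\<close> gives the general case. The traces on the predecessor \<open>Q\<close> of
  \<open>P\<close> obey the induction hypothesis, and \<open>compat_step\<close> restores the one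
  missing element.\<close>

lemma compat_lattice_below:
  assumes C: "full_chain C" and "P \<in> C" "S \<in> compat C" "T \<in> compat C" "S \<subseteq> P" "T \<subseteq> P"
  shows "joins S T \<and> S \<union> T \<in> compat C \<and> S \<inter> T \<in> compat C"
  using assms(2-)
proof (induction "card P" arbitrary: P S T)
  case 0
  then show ?case
    by (auto simp: joins_comparable empty_mem_compat)
next
  case (Suc k)
  have "Suc k \<le> CARD('n)"
    using Suc.hyps(2) by (metis card_mono finite subset_UNIV)
  then obtain Q where Q: "Q \<in> C" "card Q = k"
    using full_chain_card[OF C Suc_leD] by blast
  have QP: "Q \<subset> P"
  proof -
    have "\<not> P \<subseteq> Q"
      using Q Suc.hyps(2) card_mono[of Q P] by auto
    then show ?thesis
      using full_chain_comparable[OF C Q(1) Suc.prems(1)] by blast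
  qed
  then have "card (P - Q) = 1"
    using Q Suc.hyps(2) by (simp add: card_Diff_subset psubset_imp_subset)
  then obtain i where "P - Q = {i}"
    using card_1_singletonE by blast
  with QP have P: "P = insert i Q" and iQ: "i \<notin> Q"
    by blast+
  note step = compat_step[OF C \<open>Q \<in> C\<close> _ iQ, folded P, OF Suc.prems(1)]
  define S0 T0 where "S0 = S \<inter> Q" and "T0 = T \<inter> Q"
  have 0: "S0 \<in> compat C" "T0 \<in> compat C"
    using compat_Int_chain[OF C] Suc.prems Q by (auto simp: S0_def T0_def)
  then have IH: "joins S0 T0" "S0 \<union> T0 \<in> compat C" "S0 \<inter> T0 \<in> compat C"
    using Suc.hyps(1)[OF Q(2)[symmetric] Q(1) 0] by (auto simp: S0_def T0_def)
  \<comment> \<open>This is the hypothesis on \<open>G\<close> needed for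
    \<open>compat_step\<close>: a compatible set containing \<open>i\<close> cannot have its flat
    inside \<open>G Q\<close>, because together with \<open>Q\<close> it must reach a rank above
    \<open>card Q\<close>.\<close>
  have not_sub: "\<not> G X \<subseteq> G Q" if "i \<in> X" "X \<in> compat C" for X
  proof
    assume "G X \<subseteq> G Q"
    then have "rk (G X \<union> G Q) = card Q"
      by (simp add: Un_absorb1 rk_G)
    moreover have "rk (G X \<union> G Q) = card (X \<union> Q)"
      using that Q by (auto simp: compat_def joins_def)
    moreover have "card Q < card (X \<union> Q)"
      using that iQ by (intro psubset_card_mono) auto
    ultimately show False by simp
  qed
  show ?case
  proof (cases "i \<in> S \<union> T")
    case False
    then have "S0 = S" "T0 = T"
      using Suc.prems P by (auto simp: S0_def T0_def)
    with IH show ?thesis by simp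
  next
    case True
    then have "\<not> G S \<union> G T \<subseteq> G Q"
      using not_sub Suc.prems by blast
    then have "\<not> G S \<union> G T \<subseteq> G (S0 \<union> T0)"
      using mono_G[of "S0 \<union> T0" Q] by (auto simp: S0_def T0_def)
    then have "card (S0 \<union> T0) < rk (G S \<union> G T \<union> G T0)"
      using IH(1) G_ground[of S] G_ground[of T] mono_G[of S0 S]
      by (intro card_Un_less_rk) (auto simp: S0_def)
    moreover have "G S \<union> G T \<union> G T0 = G S \<union> G T"
      using mono_G[of T0 T] by (auto simp: T0_def)
    moreover have "S \<union> T = insert i (S0 \<union> T0)"
      using True Suc.prems P by (auto simp: S0_def T0_def)
    then have "card (S \<union> T) \<le> Suc (card (S0 \<union> T0))"
      by (simp add: card_insert_if)
    ultimately have J: "joins S T"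
      by (intro joinsI) simp
    have "S \<union> T \<in> compat C"
    proof (rule step)
      show "\<not> G (S \<union> T) \<subseteq> G Q"
        using \<open>\<not> G S \<union> G T \<subseteq> G Q\<close> mono_G[of S "S \<union> T"] mono_G[of T "S \<union> T"] by blast
      have "(S \<union> T) \<inter> Q = S0 \<union> T0"
        by (auto simp: S0_def T0_def)
      then show "(S \<union> T) \<inter> Q \<in> compat C"
        using IH by simp
    qed (use True Suc.prems in auto)
    moreover have "S \<inter> T \<in> compat C"
    proof (cases "i \<in> S \<inter> T")
      case False
      then have "S \<inter> T = S0 \<inter> T0"
        using Suc.prems P by (auto simp: S0_def T0_def)
      then show ?thesis using IH by simp
    next
      case iST: True
      have int: "(S \<inter> T) \<inter> Q = S0 \<inter> T0"
        by (auto simp: S0_def T0_def)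
      show ?thesis
      proof (rule step)
        \<comment> \<open>Otherwise intersecting the flats would place
          \<open>G (S \<inter> T)\<close> inside \<open>G (S0 \<inter> T0)\<close>, whose rank is
          too small because \<open>i\<close> is missing.\<close>
        show "\<not> G (S \<inter> T) \<subseteq> G Q"
        proof
          assume "G (S \<inter> T) \<subseteq> G Q"
          moreover have "G S0 = G S \<inter> G Q" "G T0 = G T \<inter> G Q"
            unfolding S0_def T0_def using Suc.prems Q by (auto simp: compat_def G_Int)
          ultimately have "G (S \<inter> T) \<subseteq> G (S0 \<inter> T0)"
            using G_Int[OF J] G_Int[OF IH(1)] by blast
          then have "card (S \<inter> T) \<le> card (S0 \<inter> T0)"
            using rk_mono by (metis rk_G)
          moreover have "card (S0 \<inter> T0) < card (S \<inter> T)"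
            using iST iQ by (intro psubset_card_mono) (auto simp: S0_def T0_def)
          ultimately show False by simp
        qed
        show "(S \<inter> T) \<inter> Q \<in> compat C"
          using IH int by simp
      qed (use iST Suc.prems in auto)
    qed
    ultimately show ?thesis using J by blast
  qed
qed

lemma compat_joins: "full_chain C \<Longrightarrow> S \<in> compat C \<Longrightarrow> T \<in> compat C \<Longrightarrow> joins S T"
  and compat_Un: "full_chain C \<Longrightarrow> S \<in> compat C \<Longrightarrow> T \<in> compat C \<Longrightarrow> S \<union> T \<in> compat C"
  and compat_Int: "full_chain C \<Longrightarrow> S \<in> compat C \<Longrightarrow> T \<in> compat C \<Longrightarrow> S \<inter> T \<in> compat C"
  using compat_lattice_below[OF _ UNIV_mem_full_chain] by blast+

text \<open>Members of \<open>compat C\<close> are pairwise joined, hence joined to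
  \<open>C'\<close>, so \<open>compat C\<close> lies in \<open>compat C'\<close>. Then
  \<open>C\<close> lies in \<open>compat C'\<close> too, and the same argument with the chains
  exchanged gives the other inclusion.\<close>

lemma compat_eq:
  assumes "full_chain C" "full_chain C'" "C' \<subseteq> compat C"
  shows "compat C' = compat C"
proof -
  have sub: "compat C \<subseteq> compat C'" if "full_chain C" "full_chain C'" "C' \<subseteq> compat C" for C C'
    using that compat_joins unfolding compat_def[of C'] by blast
  moreover have "C \<subseteq> compat C'"
    using sub[OF assms] chain_subset_compat[OF assms(1)] by blast
  ultimately show ?thesis
    using assms by blast
qed

text \<open>First treat \<open>Y = X \<inter> (A \<union> A')\<close>: modulo \<open>A\<close> it
  agrees with the part \<open>S'\<close> of \<open>A'\<close>, which contains
  \<open>A \<inter> A'\<close>, so shrinking \<open>A'\<close> to \<open>S'\<close> keeps it joined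
  to \<open>A\<close>. Submodularity with \<open>G (A \<union> A')\<close> then adds the rest of
  \<open>X\<close>.\<close>

lemma joins_block:
  assumes J: "joins A A'" and X: "joins X (A \<union> A')" and XU: "joins (X \<inter> (A \<union> A')) (A \<inter> A')"
  shows "joins A X"
proof -
  define U U' Y where "U = A \<inter> A'" and "U' = A \<union> A'" and "Y = X \<inter> U'"
  define S S' where "S = (Y \<union> U) \<inter> A" and "S' = (Y \<union> U) \<inter> A'"
  have "joins A S'"
    using joins_sym[OF joins_shrink[OF joins_sym[OF J], of S']] by (auto simp: S'_def U_def)
  moreover have "A \<union> S' = A \<union> Y"
    by (auto simp: S'_def Y_def U'_def U_def)
  ultimately have "card (A \<union> Y) = rk (G A \<union> G S')"
    by (simp add: joins_def)
  also have "\<dots> \<le> rk (G (Y \<union> U) \<union> G A)"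
    using mono_G[of S' "Y \<union> U"] by (intro rk_mono) (auto simp: S'_def)
  \<comment> \<open>\<open>G Y\<close> and \<open>G U\<close> span \<open>G (Y \<union> U)\<close>,
    and \<open>G U\<close> already lies in \<open>G A\<close>, so only \<open>G Y\<close> remains
    beside \<open>G A\<close>.\<close>
  also have "\<dots> = rk ((G Y \<union> G U) \<union> G A)"
  proof (rule rk_Un_absorb)
    show "G Y \<union> G U \<subseteq> G (Y \<union> U)"
      by (simp add: mono_G)
    show "rk (G Y \<union> G U) = rk (G (Y \<union> U))"
      using XU by (simp add: joins_def rk_G Y_def U_def U'_def)
  qed
  also have "(G Y \<union> G U) \<union> G A = G A \<union> G Y"
    using mono_G[of U A] by (auto simp: U_def)
  finally have 1: "card (A \<union> Y) \<le> rk (G A \<union> G Y)" .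
  have "rk ((G A \<union> G X) \<union> G U') + rk ((G A \<union> G X) \<inter> G U') \<le> rk (G A \<union> G X) + rk (G U')"
    by (rule rk_submodular)
  moreover have "(G A \<union> G X) \<union> G U' = G X \<union> G U'"
    using mono_G[of A U'] by (auto simp: U'_def)
  moreover have "rk (G A \<union> G Y) \<le> rk ((G A \<union> G X) \<inter> G U')"
    using mono_G[of A U'] mono_G[of Y X] mono_G[of Y U'] by (intro rk_mono) (auto simp: U'_def Y_def)
  ultimately have 2: "card (X \<union> U') + card (A \<union> Y) \<le> rk (G A \<union> G X) + card U'"
    using X 1 by (simp add: joins_def rk_G U'_def)
  have "card (X \<union> U') = card U' + card (X - U')"
    by (subst card_Un_disjoint[symmetric]) (auto intro: arg_cong[where f=card])
  moreover have "card (A \<union> X) = card (A \<union> Y) + card (X - U')"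
    by (subst card_Un_disjoint[symmetric]) (auto simp: Y_def U'_def intro: arg_cong[where f=card])
  ultimately show ?thesis
    using 2 by (intro joinsI) linarith
qed

text \<open>The local exchange property. For a chain member \<open>X\<close>, both sides conditions
  of \<open>joins_block\<close> hold because \<open>X\<close> and
  \<open>X \<inter> (A \<union> A')\<close> belong to the lattice of \<open>C\<close>.\<close>

lemma compat_block:
  assumes "full_chain C" "full_chain C'" "A \<in> compat C'" "A' \<in> compat C'"
    and "A \<inter> A' \<in> compat C" "A \<union> A' \<in> compat C"
  shows "A \<in> compat C"
proof -
  have "joins A X" if "X \<in> C" for X
  proof (rule joins_block)
    have X: "X \<in> compat C"
      using that chain_subset_compat assms by blast
    show "joins A A'"
      using compat_joins assms by blast
    show "joins X (A \<union> A')" "joins (X \<inter> (A \<union> A')) (A \<inter> A')"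
      using compat_joins[OF assms(1)] compat_Int[OF assms(1)] X assms(5,6) by auto
  qed
  then show ?thesis by (simp add: compat_def)
qed

lemma compat_Inter: "full_chain C \<Longrightarrow> K \<subseteq> compat C \<Longrightarrow> \<Inter>K \<in> compat C"
  using finite[of K] by (induction K rule: finite_induct) (auto simp: UNIV_mem_compat compat_Int)

lemma compat_Union: "full_chain C \<Longrightarrow> K \<subseteq> compat C \<Longrightarrow> \<Union>K \<in> compat C"
  using finite[of K] by (induction K rule: finite_induct) (auto simp: empty_mem_compat compat_Un)


section \<open>Bases adapted to all compatible sets\<close>

lemma joins_if_common_basis:
  assumes "inj b" "indep (range b)" "G S = cl (b ` S)" "G T = cl (b ` T)"
  shows "joins S T"
proof (rule joinsI)
  have "card (S \<union> T) = card (b ` (S \<union> T))"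
    using assms(1) by (simp add: card_image inj_on_subset)
  also have "\<dots> = rk (b ` (S \<union> T))"
    using assms(2) by (metis image_mono indep_subset rk_indep subset_UNIV)
  also have "\<dots> \<le> rk (G S \<union> G T)"
    unfolding assms(3,4) image_Un using indep_subset_ground[OF assms(2)]
    by (intro rk_mono Un_mono subset_cl) auto
  finally show "card (S \<union> T) \<le> rk (G S \<union> G T)" .
qed

lemma compat_basis:
  assumes C: "full_chain C" and r: "rk E = CARD('n)"
  obtains b :: "'n \<Rightarrow> 'a"
  where "inj b" "basis (range b)" "\<And>S. S \<in> compat C \<Longrightarrow> G S = cl (b ` S)"
proof -
  have ex: "\<exists>a. a \<in> G (\<Inter>{S\<in>compat C. i \<in> S}) \<and> (\<forall>Q\<in>C. i \<notin> Q \<longrightarrow> a \<notin> G Q)" for i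
  proof -
    define M where "M = \<Inter>{S\<in>compat C. i \<in> S}"
    define Q where "Q = \<Union>{Q\<in>C. i \<notin> Q}"
    have M: "M \<in> compat C" "i \<in> M"
      unfolding M_def by (auto intro: compat_Inter[OF C])
    have Q: "Q \<in> compat C" "i \<notin> Q"
      unfolding Q_def using chain_subset_compat[OF C] by (auto intro: compat_Union[OF C])
    have "card Q < card (M \<union> Q)"
      using M Q by (intro psubset_card_mono) auto
    \<comment> \<open>\<open>M\<close> and \<open>Q\<close> are joined, and \<open>M\<close> has an
      element outside \<open>Q\<close>, so \<open>G M\<close> must add rank to
      \<open>G Q\<close>.\<close>
    then have "\<not> G M \<subseteq> G Q"
      using compat_joins[OF C M(1) Q(1)] by (auto simp: joins_def rk_G Un_absorb1)
    moreover have "G Q' \<subseteq> G Q" if "Q' \<in> C" "i \<notin> Q'" for Q'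
      using that by (intro mono_G) (auto simp: Q_def)
    ultimately show ?thesis
      unfolding M_def[symmetric] by blast
  qed
  obtain b where b: "\<And>i. b i \<in> G (\<Inter>{S\<in>compat C. i \<in> S})"
      "\<And>i Q. Q \<in> C \<Longrightarrow> i \<notin> Q \<Longrightarrow> b i \<notin> G Q"
    using ex by metis
  have sub: "b ` S \<subseteq> G S" if "S \<in> compat C" for S
  proof -
    have "G (\<Inter>{T\<in>compat C. i \<in> T}) \<subseteq> G S" if "i \<in> S" for i
      using that \<open>S \<in> compat C\<close> by (intro mono_G) auto
    then show ?thesis
      using b(1) by blast
  qed
  have rk_b: "rk (b ` P) = card P" if "P \<in> C" for P
    using that
  proof (induction "card P" arbitrary: P)
    case 0
    then show ?case
      using rk_le_card[of "b ` P"] by simp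
  next
    case (Suc k)
    have "Suc k \<le> CARD('n)"
      using Suc.hyps(2) by (metis card_mono finite subset_UNIV)
    then obtain Q where Q: "Q \<in> C" "card Q = k"
      using full_chain_card[OF C Suc_leD] by blast
    have "\<not> P \<subseteq> Q"
      using Q Suc.hyps(2) card_mono[of Q P] by auto
    then have "Q \<subseteq> P"
      using full_chain_comparable[OF C Q(1) Suc.prems(1)] by blast
    obtain i where i: "i \<in> P" "i \<notin> Q"
      using \<open>\<not> P \<subseteq> Q\<close> by blast
    have bQ: "b ` Q \<subseteq> G Q"
      using sub chain_subset_compat[OF C] Q by blast
    have "rk (b ` Q) < rk (insert (b i) (b ` Q))"
    proof (rule ccontr)
      assume "\<not> ?thesis"
      then have "rk (b ` Q \<union> {b i}) = rk (b ` Q)"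
        using rk_mono[OF subset_insertI, of "b ` Q" "b i"] by simp
      then have "{b i} \<subseteq> G Q"
        using b(1)[of i] G_ground by (intro flat_absorb[OF flat_G bQ]) auto
      then show False
        using b(2)[OF Q(1) i(2)] by simp
    qed
    also have "\<dots> \<le> rk (b ` P)"
      using i \<open>Q \<subseteq> P\<close> by (intro rk_mono) auto
    finally have "k < rk (b ` P)"
      using Suc.hyps(1) Q by auto
    moreover have "rk (b ` P) \<le> card P"
      by (meson card_image_le finite finite_imageI le_trans rk_le_card)
    ultimately show ?case
      using Suc.hyps(2) by linarith
  qed
  have rk_range: "rk (range b) = CARD('n)"
    using rk_b[OF UNIV_mem_full_chain[OF C]] .
  moreover have "rk (range b) \<le> card (range b)" "card (range b) \<le> CARD('n)"
    by (simp_all add: rk_le_card card_image_le)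
  ultimately have card: "card (range b) = CARD('n)"
    by linarith
  then have inj: "inj b"
    by (simp add: eq_card_imp_inj_on)
  have ind: "indep (range b)"
    using rk_range card by (intro indep_if_rk_eq_card) auto
  have "I = range b" if I: "indep I" "range b \<subseteq> I" for I
  proof -
    have "card I \<le> card (range b)"
      using indep_card_le_rk[OF indep_subset_ground I(1)] I r card by simp
    then show ?thesis
      using I by (metis card_seteq indep_finite)
  qed
  then have "basis (range b)"
    using ind by (auto simp: basis_def)
  moreover have "G S = cl (b ` S)" if "S \<in> compat C" for S
  proof (rule cl_eq_flat[symmetric, OF flat_G sub[OF that]])
    have "indep (b ` S)"
      using ind by (rule indep_subset) blast
    then show "rk (b ` S) = rk (G S)"
      using inj by (simp add: rk_indep rk_G card_image inj_on_subset)
  qed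
  ultimately show ?thesis
    using inj that by blast
qed

section \<open>The cone of a full chain\<close>

definition chain_cone :: "'n set set \<Rightarrow> (real ^ 'n) set" where
  "chain_cone C = {x. \<forall>c. {i. c \<le> x $ i} \<in> compat C}"

text \<open>A finite lattice of sets containing \<open>{}\<close> and \<open>UNIV\<close> consists
  of all upsets of its preorder: such an upset is the union of the least members around its
  elements.\<close>

lemma compat_upsetI:
  assumes "full_chain C" "\<And>i j. j \<in> S \<Longrightarrow> (\<forall>T\<in>compat C. j \<in> T \<longrightarrow> i \<in> T) \<Longrightarrow> i \<in> S"
  shows "S \<in> compat C"
proof -
  have "S = (\<Union>j\<in>S. \<Inter>{T\<in>compat C. j \<in> T})"
    using assms(2) by blast
  also have "\<dots> \<in> compat C"
    using assms(1) by (intro compat_Union) (auto intro: compat_Inter)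
  finally show ?thesis .
qed

text \<open>This replaces conditions on superlevel sets by finitely many linear inequalities, from
  which convexity and polyhedrality follow directly.\<close>

lemma chain_cone_iff:
  assumes "full_chain C"
  shows "x \<in> chain_cone C \<longleftrightarrow> (\<forall>i j. (\<forall>T\<in>compat C. j \<in> T \<longrightarrow> i \<in> T) \<longrightarrow> x $ j \<le> x $ i)"
    (is "_ \<longleftrightarrow> ?R")
proof
  assume x: "x \<in> chain_cone C"
  show ?R
  proof (intro allI impI)
    fix i j assume *: "\<forall>T\<in>compat C. j \<in> T \<longrightarrow> i \<in> T"
    have "{k. x $ j \<le> x $ k} \<in> compat C"
      using x by (simp add: chain_cone_def)
    from bspec[OF * this] show "x $ j \<le> x $ i" by simp
  qed
next
  assume x: ?R
  have "{i. c \<le> x $ i} \<in> compat C" for c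
  proof (rule compat_upsetI[OF assms])
    fix i j assume "j \<in> {i. c \<le> x $ i}" "\<forall>T\<in>compat C. j \<in> T \<longrightarrow> i \<in> T"
    with x show "i \<in> {i. c \<le> x $ i}"
      by (metis mem_Collect_eq order_trans)
  qed
  then show "x \<in> chain_cone C"
    by (simp add: chain_cone_def)
qed

lemma chain_cone_strict:
  assumes "full_chain C" "x \<in> chain_cone C"
  shows "{i. c < x $ i} \<in> compat C"
proof (rule compat_upsetI[OF assms(1)])
  fix i j assume "j \<in> {i. c < x $ i}" "\<forall>T\<in>compat C. j \<in> T \<longrightarrow> i \<in> T"
  moreover from this(2) have "x $ j \<le> x $ i"
    using assms(2) unfolding chain_cone_iff[OF assms(1)] by simp
  ultimately show "i \<in> {i. c < x $ i}"
    by simp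
qed

lemma convex_cone_chain_cone:
  assumes "full_chain C" shows "convex_cone (chain_cone C)"
  unfolding convex_cone_iff chain_cone_iff[OF assms]
proof (intro conjI ballI allI impI)
  fix x y :: "real ^ 'n" and i j
  assume "x \<in> chain_cone C" "y \<in> chain_cone C" "\<forall>T\<in>compat C. j \<in> T \<longrightarrow> i \<in> T"
  then show "(x + y) $ j \<le> (x + y) $ i"
    unfolding chain_cone_iff[OF assms] vector_add_component by (meson add_mono)
next
  fix x :: "real ^ 'n" and c :: real and i j
  assume "x \<in> chain_cone C" "0 \<le> c" "\<forall>T\<in>compat C. j \<in> T \<longrightarrow> i \<in> T"
  then show "(c *\<^sub>R x) $ j \<le> (c *\<^sub>R x) $ i"
    unfolding chain_cone_iff[OF assms] vector_scaleR_component real_scaleR_def by (meson mult_left_mono)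
qed simp

lemma polyhedron_chain_cone:
  assumes "full_chain C" shows "polyhedron (chain_cone C)"
proof -
  define R where "R = {(i, j). \<forall>T\<in>compat C. j \<in> T \<longrightarrow> i \<in> T}"
  have "chain_cone C = (\<Inter>(i, j)\<in>R. {x. (axis j 1 - axis i 1) \<bullet> x \<le> 0})"
    by (auto simp: chain_cone_iff[OF assms] R_def inner_diff_left inner_axis' inner_real_def)
  then show ?thesis
    by (auto intro!: polyhedron_Inter polyhedron_halfspace_le)
qed

section \<open>Flag cones inside chain cones\<close>

lemma e_nth: "e S $ i = (if i \<in> S then 1 else 0)"
  by (simp add: e_def axis_def)

lemma e_mem_chain_cone_iff: "e S \<in> chain_cone C \<longleftrightarrow> S \<in> compat C"
proof
  assume "e S \<in> chain_cone C"
  then have "{i. 1 \<le> e S $ i} \<in> compat C"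
    unfolding chain_cone_def by blast
  moreover have "{i. 1 \<le> e S $ i} = S"
    by (auto simp: e_nth split: if_splits)
  ultimately show "S \<in> compat C"
    by simp
next
  assume S: "S \<in> compat C"
  have "{i. c \<le> e S $ i} = (if c \<le> 0 then UNIV else if c \<le> 1 then S else {})" for c
    by (auto simp: e_nth)
  then show "e S \<in> chain_cone C"
    using S by (simp add: chain_cone_def UNIV_mem_compat empty_mem_compat)
qed

text \<open>A convex cone contains \<open>flag_cone W\<close> once it contains the generators and
  the line through \<open>e UNIV\<close>. Constant vectors satisfy every inequality of
  \<open>chain_cone_iff\<close>, so only the generators matter.\<close>

lemma flag_cone_subset_iff:
  assumes C: "full_chain C" and W: "W \<in> Fl"
  shows "flag_cone W \<subseteq> chain_cone C \<longleftrightarrow> set W \<subseteq> compat C"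
proof
  assume sub: "flag_cone W \<subseteq> chain_cone C"
  have "S \<in> compat C" if "S \<in> set (butlast W)" for S
  proof -
    have "e S + 0 *\<^sub>R e UNIV \<in> flag_cone W"
      unfolding flag_cone_def using that by (blast intro: hull_inc)
    then show ?thesis
      using sub e_mem_chain_cone_iff[of S C] by (simp add: subset_iff)
  qed
  \<comment> \<open>\<open>flag_cone\<close> has no generator for the last set \<open>UNIV\<close>,
    which is compatible anyway.\<close>
  moreover have "W \<noteq> []" "last W = UNIV"
    using W by (auto simp: Fl_def is_flag_def split: if_splits)
  then have "set W = insert UNIV (set (butlast W))"
    by (metis append_butlast_last_id list.simps(15) rotate1.simps(2) set_rotate1)
  ultimately show "set W \<subseteq> compat C"
    by (auto simp: UNIV_mem_compat)
next
  assume sub: "set W \<subseteq> compat C"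
  have "convex_cone hull (e ` set (butlast W)) \<subseteq> chain_cone C"
    using sub by (intro hull_minimal convex_cone_chain_cone[OF C])
      (auto simp: e_mem_chain_cone_iff dest: in_set_butlastD)
  moreover have "t *\<^sub>R e UNIV \<in> chain_cone C" for t
    by (simp add: chain_cone_iff[OF C] e_nth)
  ultimately show "flag_cone W \<subseteq> chain_cone C"
    unfolding flag_cone_def using convex_cone_add[OF convex_cone_chain_cone[OF C]] by blast
qed

text \<open>
  On a level set of \<open>z\<close>, small values of \<open>x\<close> are large values of \<open>y\<close>. So a superlevel set of \<open>x\<close>
  between two consecutive superlevel sets of \<open>z\<close> has a relative complement compatible with \<open>C'\<close>,
  namely a superlevel set of \<open>y\<close>, and \<open>compat_block\<close> applies.
\<close>

lemma near_segment_mem: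
  assumes C: "full_chain C" "full_chain C'"
    and x: "x \<in> chain_cone C'" and y: "y \<in> chain_cone C'"
    and t: "0 < t" "t < 1" and z: "z = (1 - t) *\<^sub>R x + t *\<^sub>R y"
    and zC: "z \<in> chain_cone C"
    and near: "\<And>i j. z $ j < z $ i \<Longrightarrow> x $ j < x $ i"
  shows "x \<in> chain_cone C"
  unfolding chain_cone_def
proof (intro CollectI allI)
  fix c
  define A where "A = {i. c \<le> x $ i}"
  have zC': "z \<in> chain_cone C'"
    unfolding z using convex_cone_chain_cone[OF C(2)] x y t by (simp add: convex_cone_iff)
  show "A \<in> compat C"
  proof (cases "A = {}")
    case True
    then show ?thesis by (simp add: empty_mem_compat)
  next
    case False
    \<comment> \<open>The lowest level of \<open>z\<close> met by \<open>A\<close>. By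
      \<open>near\<close>, everything strictly above this level lies in \<open>A\<close>, so
      \<open>A\<close> is undetermined only on the level itself.\<close>
    define d where "d = Min ((\<lambda>i. z $ i) ` A)"
    have d_le: "d \<le> z $ i" if "i \<in> A" for i
      using that by (simp add: d_def)
    have "d \<in> (\<lambda>i. z $ i) ` A"
      unfolding d_def using False by (intro Min_in) auto
    then obtain k where k: "k \<in> A" "z $ k = d"
      by blast
    have above: "i \<in> A" if "d < z $ i" for i
      using near[of k i] k that by (auto simp: A_def)
    \<comment> \<open>Solving \<open>d = (1 - t) * c + t * c'\<close>: on the level
      \<open>z $ i = d\<close>, the condition \<open>x $ i < c\<close> is the same as
      \<open>c' < y $ i\<close>.\<close>
    define c' where "c' = (d - (1 - t) * c) / t"
    have level: "x $ i < c \<longleftrightarrow> c' < y $ i" if "z $ i = d" for i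
    proof -
      have "d = (1 - t) * x $ i + t * y $ i"
        using that by (simp add: z)
      moreover have "c' < y $ i \<longleftrightarrow> d - (1 - t) * c < t * y $ i"
        using t by (simp add: c'_def divide_less_eq mult.commute)
      ultimately have "c' < y $ i \<longleftrightarrow> (1 - t) * x $ i < (1 - t) * c"
        by linarith
      then show ?thesis
        using t by simp
    qed
    \<comment> \<open>All indices strictly above level \<open>d\<close>, together with the part of
      that level outside \<open>A\<close>. Written with superlevel sets of \<open>y\<close> and
      \<open>z\<close>, it is visibly compatible with \<open>C'\<close>.\<close>
    define A' where "A' = ({i. c' < y $ i} \<inter> {i. d \<le> z $ i}) \<union> {i. d < z $ i}"
    have mem_A': "i \<in> A' \<longleftrightarrow> d < z $ i \<or> z $ i = d \<and> i \<notin> A" for i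
      using level[of i] by (auto simp: A'_def A_def)
    have "A \<inter> A' = {i. d < z $ i}"
      using above mem_A' by blast
    moreover have "i \<in> A \<union> A' \<longleftrightarrow> i \<in> {i. d \<le> z $ i}" for i
      using d_le[of i] mem_A'[of i] by (auto simp: le_less)
    then have "A \<union> A' = {i. d \<le> z $ i}"
      by blast
    moreover have "A \<in> compat C'"
      using x by (simp add: A_def chain_cone_def)
    moreover have "A' \<in> compat C'"
    proof -
      have "{i. d \<le> z $ i} \<in> compat C'"
        using zC' by (simp add: chain_cone_def)
      then show ?thesis
        unfolding A'_def
        using compat_Un[OF C(2)] compat_Int[OF C(2)] chain_cone_strict[OF C(2)] y zC' by meson
    qed
    moreover have "{i. d \<le> z $ i} \<in> compat C"
      using zC by (simp add: chain_cone_def)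
    ultimately show ?thesis
      using compat_block[OF C, of A A'] chain_cone_strict[OF C(1) zC] by metis
  qed
qed

text \<open>Strict inequalities between the finitely many coordinates of \<open>z\<close> survive a
  small move towards \<open>x\<close>.\<close>

lemma segment_near:
  fixes x z :: "real ^ 'n"
  shows "\<exists>s. 0 < s \<and> s < 1 \<and> (\<forall>i j. z $ j < z $ i \<longrightarrow> (z + s *\<^sub>R (x - z)) $ j < (z + s *\<^sub>R (x - z)) $ i)"
proof -
  have "\<forall>\<^sub>F s in at_right 0. z $ j < z $ i \<longrightarrow> (z + s *\<^sub>R (x - z)) $ j < (z + s *\<^sub>R (x - z)) $ i" for i j
  proof (cases "z $ j < z $ i")
    case True
    have "((\<lambda>s. (z + s *\<^sub>R (x - z)) $ i - (z + s *\<^sub>R (x - z)) $ j) \<longlongrightarrow> (z + 0 *\<^sub>R (x - z)) $ i - (z + 0 *\<^sub>R (x - z)) $ j) (at_right 0)"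
      by (intro tendsto_intros)
    then have "\<forall>\<^sub>F s in at_right 0. 0 < (z + s *\<^sub>R (x - z)) $ i - (z + s *\<^sub>R (x - z)) $ j"
      using True by (intro order_tendstoD(1)) auto
    then show ?thesis
      by eventually_elim simp
  qed simp
  then have "\<forall>\<^sub>F s in at_right 0. \<forall>i j. z $ j < z $ i \<longrightarrow> (z + s *\<^sub>R (x - z)) $ j < (z + s *\<^sub>R (x - z)) $ i"
    by (intro eventually_all_finite)
  moreover have "\<forall>\<^sub>F s in at_right (0::real). 0 < s \<and> s < 1"
    by (auto simp: eventually_at_right_field intro: exI[of _ 1])
  ultimately have "\<forall>\<^sub>F s in at_right 0. 0 < s \<and> s < 1 \<and> (\<forall>i j. z $ j < z $ i \<longrightarrow> (z + s *\<^sub>R (x - z)) $ j < (z + s *\<^sub>R (x - z)) $ i)"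
    by eventually_elim blast
  then show ?thesis
    using eventually_happens trivial_limit_at_right_real by blast
qed

text \<open>The extremality condition for faces, without the assumption \<open>near\<close> of
  \<open>near_segment_mem\<close>.\<close>

lemma segment_mem:
  assumes C: "full_chain C" "full_chain C'"
    and x: "x \<in> chain_cone C'" and y: "y \<in> chain_cone C'"
    and t: "0 < t" "t < 1" and z: "z = (1 - t) *\<^sub>R x + t *\<^sub>R y"
    and zC: "z \<in> chain_cone C"
  shows "x \<in> chain_cone C"
proof -
  text \<open>Walk from \<open>z\<close> towards \<open>x\<close>; the last point in the cone of \<open>C\<close> cannot lie before \<open>x\<close>.\<close>
  define p where "p u = (1 - u) *\<^sub>R x + u *\<^sub>R y" for u
  define I where "I = {0..t} \<inter> p -` chain_cone C"
  have "continuous_on UNIV p"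
    unfolding p_def by (intro continuous_intros)
  then have "closed (p -` chain_cone C)"
    using polyhedron_chain_cone[OF C(1)] polyhedron_imp_closed by (intro closed_vimage) auto
  then have "compact I"
    unfolding I_def by (intro compact_Int_closed) auto
  moreover have "t \<in> I"
    using t zC z by (simp add: I_def p_def)
  \<comment> \<open>Here \<open>p 0 = x\<close> and \<open>p t = z\<close>, so the least parameter
    in the closed set \<open>I\<close> is the point of the cone nearest to \<open>x\<close>.\<close>
  ultimately obtain u where u: "u \<in> I" "\<And>v. v \<in> I \<Longrightarrow> u \<le> v"
    using compact_attains_inf[of I] by auto
  have "u = 0"
  proof (rule ccontr)
    assume "u \<noteq> 0"
    then have u0: "0 < u" "u < 1" "u \<le> t"
      using u(1) t by (auto simp: I_def)
    obtain s where s: "0 < s" "s < 1"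
      "\<And>i j. p u $ j < p u $ i \<Longrightarrow> (p u + s *\<^sub>R (x - p u)) $ j < (p u + s *\<^sub>R (x - p u)) $ i"
      using segment_near[of "p u" x] by blast
    define v where "v = (1 - s) * u"
    have v: "0 < v" "v < u"
      using s u0 by (auto simp: v_def)
    have pv: "p u + s *\<^sub>R (x - p u) = p v"
      by (simp add: p_def v_def algebra_simps)
    have "p v \<in> chain_cone C"
    \<comment> \<open>The point \<open>p u\<close> lies between \<open>p v\<close> and
      \<open>y\<close> at ratio \<open>(u - v) / (1 - v)\<close>, so \<open>p v\<close> and
      \<open>p u\<close> take the places of \<open>x\<close> and \<open>z\<close>.\<close>
    proof (rule near_segment_mem[OF C _ y])
      show "p v \<in> chain_cone C'"
        unfolding p_def using convex_cone_chain_cone[OF C(2)] x y v u0 by (simp add: convex_cone_iff)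
      show "0 < (u - v) / (1 - v)" "(u - v) / (1 - v) < 1"
        using v u0 by (auto simp: divide_simps)
      define w where "w = (u - v) / (1 - v)"
      have w: "w * (1 - v) = u - v"
        using v u0 by (simp add: w_def)
      then have "1 - u = (1 - w) * (1 - v)" "u = (1 - w) * v + w"
        by (simp_all add: algebra_simps)
      then show "p u = (1 - (u - v) / (1 - v)) *\<^sub>R p v + ((u - v) / (1 - v)) *\<^sub>R y"
        unfolding w_def[symmetric] p_def
        by (metis (no_types) add.assoc scaleR_add_left scaleR_add_right scaleR_scaleR)
      show "p u \<in> chain_cone C"
        using u(1) by (simp add: I_def)
      show "p v $ j < p v $ i" if "p u $ j < p u $ i" for i j
        using s(3)[OF that] pv by simp
    qed
    then have "v \<in> I"
      using v u0 by (simp add: I_def)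
    then show False
      using u(2) v by force
  qed
  then show ?thesis
    using u(1) by (simp add: I_def p_def)
qed

lemma chain_cone_Int_face:
  assumes C: "full_chain C" "full_chain C'"
  shows "chain_cone C \<inter> chain_cone C' face_of chain_cone C'"
  unfolding face_of_def
proof (intro conjI ballI impI)
  show "convex (chain_cone C \<inter> chain_cone C')"
    using convex_cone_chain_cone C by (intro convex_Int) (auto simp: convex_cone_def)
  fix a b x assume ab: "a \<in> chain_cone C'" "b \<in> chain_cone C'"
    and "x \<in> chain_cone C \<inter> chain_cone C'" "x \<in> open_segment a b"
  then obtain t where t: "0 < t" "t < 1" "x = (1 - t) *\<^sub>R a + t *\<^sub>R b" and x: "x \<in> chain_cone C"
    by (auto simp: in_segment)
  show "a \<in> chain_cone C \<inter> chain_cone C'"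
    using segment_mem[OF C ab t x] ab by blast
  \<comment> \<open>Reversing the segment gives the statement for the other endpoint.\<close>
  have "x = (1 - (1 - t)) *\<^sub>R b + (1 - t) *\<^sub>R a"
    using t by simp
  then show "b \<in> chain_cone C \<inter> chain_cone C'"
    using segment_mem[OF C ab(2,1) _ _ _ x, of "1 - t"] t ab by simp
qed simp


section \<open>The fan\<close>

definition flag_fan :: "(real ^ 'n) set set" where
  "flag_fan = {D. D \<noteq> {} \<and> (\<exists>W. full_flag W \<and> D face_of chain_cone (insert {} (set W)))}"

lemma chain_cone_mem_flag_fan:
  assumes "full_flag W" shows "chain_cone (insert {} (set W)) \<in> flag_fan"
proof -
  have "convex_cone (chain_cone (insert {} (set W)))"
    by (rule convex_cone_chain_cone[OF full_flag_full_chain[OF assms]])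
  then show ?thesis
    using assms by (auto simp: flag_fan_def convex_cone_def face_of_refl)
qed

lemma finite_flag_fan: "finite flag_fan"
proof -
  have "{W :: 'n set list. full_flag W} \<subseteq> {W. set W \<subseteq> UNIV \<and> length W = CARD('n)}"
    by (auto simp: full_flag_def)
  then have "finite {W :: 'n set list. full_flag W}"
    by (rule finite_subset) (rule finite_lists_length_eq, simp)
  moreover have "finite {D. D face_of chain_cone (insert {} (set W))}" if "full_flag W" for W
    by (rule finite_polyhedron_faces[OF polyhedron_chain_cone[OF full_flag_full_chain[OF that]]])
  ultimately have "finite (\<Union>W\<in>{W. full_flag W}. {D. D face_of chain_cone (insert {} (set W))})"
    by blast
  then show ?thesis
    by (rule finite_subset[rotated]) (auto simp: flag_fan_def)
qed

text \<open>Faces of faces are faces, so the closure under faces is built in. The intersection axiom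
  reduces from arbitrary faces to the chain cones themselves, where it is
  \<open>chain_cone_Int_face\<close>.\<close>

lemma is_fan_flag_fan: "is_fan flag_fan"
  unfolding is_fan_def
proof (intro conjI ballI allI impI)
  obtain W :: "'n set list" where "full_flag W"
    using chain_extends_to_full_flag[of "{}"] by blast
  then show "flag_fan \<noteq> {}"
    using chain_cone_mem_flag_fan by blast
  show "finite flag_fan" by (rule finite_flag_fan)
next
  fix D assume "D \<in> flag_fan"
  then obtain W where D: "D \<noteq> {}" "D face_of chain_cone (insert {} (set W))" and "full_flag W"
    by (auto simp: flag_fan_def)
  note C = full_flag_full_chain[OF \<open>full_flag W\<close>]
  have "polyhedron D"
    by (rule face_of_polyhedron_polyhedron[OF polyhedron_chain_cone[OF C] D(2)])
  moreover have "conic D"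
    using convex_cone_chain_cone[OF C] D(2) face_of_conic unfolding convex_cone_def by blast
  ultimately show "polyhedral_cone D"
    using D by (auto simp: polyhedral_cone_def convex_cone_def face_of_imp_convex)
  fix D' assume "D' face_of D" "D' \<noteq> {}"
  then show "D' \<in> flag_fan"
    using D(2) \<open>full_flag W\<close> face_of_trans unfolding flag_fan_def by blast
next
  fix D D' assume "D \<in> flag_fan" "D' \<in> flag_fan"
  then obtain W W' where W: "full_flag W" "D face_of chain_cone (insert {} (set W))"
    and W': "full_flag W'" "D' face_of chain_cone (insert {} (set W'))"
    by (auto simp: flag_fan_def)
  note faces = chain_cone_Int_face[OF full_flag_full_chain full_flag_full_chain]
  show "D \<inter> D' face_of D" "D \<inter> D' face_of D'"
    using face_of_Int_subface[OF _ faces[OF W(1) W'(1)] W(2) W'(2)] faces[OF W'(1) W(1)]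
    by (simp_all add: Int_commute)
qed

lemma chain_compat_full_flag:
  fixes K :: "'n set set"
  assumes "\<And>S T. S \<in> K \<Longrightarrow> T \<in> K \<Longrightarrow> S \<subseteq> T \<or> T \<subseteq> S"
  obtains W where "full_flag W" "K \<subseteq> compat (insert {} (set W))"
proof -
  obtain W where "full_flag W" "K \<subseteq> insert {} (set W)"
    using chain_extends_to_full_flag[OF assms] by blast
  then show ?thesis
    using that chain_subset_compat[OF full_flag_full_chain] by blast
qed

text \<open>The superlevel sets of any vector form a chain, and a full flag extending that chain has
  a cone containing the vector.\<close>

lemma complete_fan_flag_fan: "complete_fan flag_fan"
proof -
  have "x \<in> \<Union>flag_fan" for x :: "real ^ 'n"
  proof -
    have "S \<subseteq> T \<or> T \<subseteq> S"
      if "S \<in> range (\<lambda>c. {i. c \<le> x $ i})" "T \<in> range (\<lambda>c. {i. c \<le> x $ i})" for S T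
    proof -
      from that(1) obtain c where c: "S = {i. c \<le> x $ i}" ..
      from that(2) obtain d where d: "T = {i. d \<le> x $ i}" ..
      show ?thesis
        unfolding c d using linear[of c d] by auto
    qed
    then obtain W where W: "full_flag W"
        "range (\<lambda>c. {i. c \<le> x $ i}) \<subseteq> compat (insert {} (set W))"
      using chain_compat_full_flag by metis
    then have "x \<in> chain_cone (insert {} (set W))"
      by (auto simp: chain_cone_def)
    then show ?thesis
      using chain_cone_mem_flag_fan[OF W(1)] by blast
  qed
  then show ?thesis
    using is_fan_flag_fan by (auto simp: complete_fan_def)
qed

lemma coarsens_flag_fan: "coarsens flag_fan permutohedral_fan"
  unfolding coarsens_def permutohedral_fan_def
proof
  fix K :: "(real ^ 'n) set" assume "K \<in> flag_cone ` Fl"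
  then obtain V where V: "V \<in> Fl" "K = flag_cone V"
    by blast
  have "sorted_wrt (\<subset>) V"
    using V by (simp add: Fl_def is_flag_def)
  then have "S \<subseteq> T \<or> T \<subseteq> S" if "S \<in> set V" "T \<in> set V" for S T
    using that by (metis in_set_conv_nth linorder_neqE_nat order_refl psubset_imp_subset sorted_wrt_iff_nth_less)
  then obtain W where W: "full_flag W" "set V \<subseteq> compat (insert {} (set W))"
    using chain_compat_full_flag[of "set V"] by metis
  then have "K \<subseteq> chain_cone (insert {} (set W))"
    using V flag_cone_subset_iff[OF full_flag_full_chain] by blast
  then show "\<exists>D\<in>flag_fan. K \<subseteq> D"
    using chain_cone_mem_flag_fan[OF W(1)] by blast
qed

lemma compat_full_flag_eq:
  assumes "full_flag W" "full_flag W'" "set W' \<subseteq> compat (insert {} (set W))"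
  shows "compat (insert {} (set W')) = compat (insert {} (set W))"
  using assms by (intro compat_eq full_flag_full_chain) (simp_all add: empty_mem_compat)

text \<open>A cone of the fan containing both flag cones lies in some \<open>chain_cone\<close>, and
  both flags then have its lattice. Conversely the cone of \<open>W\<close> itself merges them; its
  maximality holds because any chain cone containing it has the same lattice, hence is the same
  cone.\<close>

lemma merged_in_flag_fan_iff:
  assumes W: "full_flag W" and W': "full_flag W'"
  shows "merged_in flag_fan (flag_cone W) (flag_cone W') \<longleftrightarrow> set W' \<subseteq> compat (insert {} (set W))"
proof
  have Fl: "W \<in> Fl" "W' \<in> Fl"
    using assms by (auto simp: full_flag_def)
  note sub_iff = flag_cone_subset_iff[OF full_flag_full_chain]
  {
    assume "merged_in flag_fan (flag_cone W) (flag_cone W')"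
    then obtain D where D: "D \<in> flag_fan" "flag_cone W \<subseteq> D" "flag_cone W' \<subseteq> D"
      by (auto simp: merged_in_def maximal_cone_def)
    then obtain V where V: "full_flag V" "D \<subseteq> chain_cone (insert {} (set V))"
      unfolding flag_fan_def using face_of_imp_subset by blast
    then have "set W \<subseteq> compat (insert {} (set V))" "set W' \<subseteq> compat (insert {} (set V))"
      using sub_iff[OF V(1)] Fl D by blast+
    then show "set W' \<subseteq> compat (insert {} (set W))"
      using compat_full_flag_eq[OF V(1) W] by simp
  }
  assume W'sub: "set W' \<subseteq> compat (insert {} (set W))"
  have Wsub: "set W \<subseteq> compat (insert {} (set W))"
    using chain_subset_compat[OF full_flag_full_chain[OF W]] by blast
  have "D = chain_cone (insert {} (set W))"
    if D: "D \<in> flag_fan" "chain_cone (insert {} (set W)) \<subseteq> D" for D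
  proof -
    obtain V where V: "full_flag V" "D \<subseteq> chain_cone (insert {} (set V))"
      using D(1) unfolding flag_fan_def using face_of_imp_subset by blast
    then have "flag_cone W \<subseteq> chain_cone (insert {} (set V))"
      using D Wsub sub_iff[OF W Fl(1)] by blast
    then have "compat (insert {} (set W)) = compat (insert {} (set V))"
      using sub_iff[OF V(1) Fl(1)] compat_full_flag_eq[OF V(1) W] by blast
    then show ?thesis
      using V D by (auto simp: chain_cone_def)
  qed
  then have "maximal_cone flag_fan (chain_cone (insert {} (set W)))"
    using chain_cone_mem_flag_fan[OF W] by (auto simp: maximal_cone_def)
  then show "merged_in flag_fan (flag_cone W) (flag_cone W')"
    using W'sub Wsub sub_iff[OF W] Fl unfolding merged_in_def by blast
qed

lemma common_basis_iff:
  assumes r: "rk E = CARD('n)" and W: "full_flag W" and W': "full_flag W'"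
  shows "(\<exists>b :: 'n \<Rightarrow> 'a. ordered_basis b \<and> (\<forall>S\<in>set W. G S = cl (b ` S)) \<and> (\<forall>S\<in>set W'. G S = cl (b ` S)))
    \<longleftrightarrow> set W' \<subseteq> compat (insert {} (set W))" (is "?L \<longleftrightarrow> ?R")
proof
  assume ?L
  then obtain b :: "'n \<Rightarrow> 'a" where b: "inj b" "indep (range b)"
    "\<And>S. S \<in> set W \<Longrightarrow> G S = cl (b ` S)" "\<And>S. S \<in> set W' \<Longrightarrow> G S = cl (b ` S)"
    by (auto simp: ordered_basis_def basis_def)
  then show ?R
    using joins_if_common_basis[OF b(1,2)] by (auto simp: compat_def joins_comparable joins_sym)
next
  assume ?R
  moreover obtain b :: "'n \<Rightarrow> 'a" where "inj b" "basis (range b)"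
    "\<And>S. S \<in> compat (insert {} (set W)) \<Longrightarrow> G S = cl (b ` S)"
    using compat_basis[OF full_flag_full_chain[OF W] r] by blast
  ultimately show ?L
    using chain_subset_compat[OF full_flag_full_chain[OF W]] unfolding ordered_basis_def by blast
qed

end

section \<open>Flag decorations\<close>

context matroid
begin

text \<open>The value on \<open>S\<close> is read off the two-step flag \<open>[S, UNIV]\<close>.
  For \<open>S = {}\<close> and \<open>S = UNIV\<close> this list is not a flag, so those values are
  set by hand.\<close>

definition decoration_flat :: "('n::finite set list \<Rightarrow> 'a set list) \<Rightarrow> 'n set \<Rightarrow> 'a set" where
  "decoration_flat F S = (if S = {} then {} else if S = UNIV then E else hd (F [S, UNIV]))"

text \<open>\<open>W\<close> refines \<open>[W ! i, UNIV]\<close>, so the flat assigned to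
  \<open>W ! i\<close> there occurs somewhere in \<open>F W\<close>. Its rank fixes the position,
  since the sets of \<open>W\<close> have distinct cardinalities.\<close>

lemma decoration_nth:
  fixes F :: "'n::finite set list \<Rightarrow> 'a set list"
  assumes F: "flag_decoration F" and W: "W \<in> Fl" "i < length W"
  shows "F W ! i = decoration_flat F (W ! i)"
proof -
  have srt: "sorted_wrt (\<subset>) ({} # W)" "last ({} # W) = UNIV"
    using W by (auto simp: Fl_def is_flag_def)
  then have lt: "W ! j \<subset> W ! k" if "j < k" "k < length W" for j k
    using that by (simp add: sorted_wrt_iff_nth_less[of _ W])
  have ne: "W ! i \<noteq> {}"
    using srt W(2) by (auto dest: nth_mem)
  have FW: "is_flag E (F W)" "length (F W) = length W"
    using F W by (auto simp: flag_decoration_def flags_of_flats_def)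
  show ?thesis
  proof (cases "W ! i = UNIV")
    case True
    have "\<not> Suc i < length W"
      using lt[of i "Suc i"] True by auto
    then have "i = length (F W) - 1" "F W \<noteq> []"
      using W FW by auto
    moreover have "last (F W) = E"
      using FW \<open>F W \<noteq> []\<close> by (simp add: is_flag_def)
    ultimately show ?thesis
      using True by (simp add: decoration_flat_def last_conv_nth)
  next
    case False
    define V where "V = [W ! i, UNIV]"
    have V: "V \<in> Fl"
      using ne False by (auto simp: V_def Fl_def is_flag_def)
    have "UNIV \<in> set W"
      using srt W(2) by (metis last_ConsR last_in_set length_greater_0_conv list.size(3) not_less_zero)
    then have "refines W V"
      using W(2) by (auto simp: refines_def V_def)
    then have "set (F V) \<subseteq> set (F W)"
      using F V W by (auto simp: flag_decoration_def refines_def)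
    moreover have "length (F V) = 2" and rkV: "rk (F V ! 0) = card (W ! i)"
      using F V by (auto simp: flag_decoration_def V_def)
    then have hd: "hd (F V) = F V ! 0" "F V ! 0 \<in> set (F V)"
      by (auto intro!: hd_conv_nth nth_mem)
    ultimately obtain j where j: "j < length W" "F W ! j = F V ! 0"
      using FW by (metis in_set_conv_nth subsetD)
    then have "card (W ! j) = card (W ! i)"
      using F W rkV by (metis flag_decoration_def)
    then have "j = i"
      using lt W(2) j(1) by (metis finite less_irrefl linorder_neqE_nat psubset_card_mono)
    then show ?thesis
      using j hd ne False by (simp add: decoration_flat_def V_def)
  qed
qed

text \<open>Looplessness makes \<open>{}\<close> a flat, and the rank of \<open>E\<close> settles
  the value at \<open>UNIV\<close>. Monotonicity for proper nonempty \<open>S \<subset> T\<close>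
  comes from the three-step flag \<open>[S, T, UNIV]\<close>.\<close>

lemma flat_family_decoration_flat:
  fixes F :: "'n::finite set list \<Rightarrow> 'a set list"
  assumes F: "flag_decoration F" and "loopless" and r: "rk E = CARD('n)"
  shows "flat_family E indep (decoration_flat F)"
proof -
  have val: "flat (decoration_flat F S) \<and> rk (decoration_flat F S) = card S" for S
  proof -
    consider "S = {}" | "S = UNIV" | "[S, UNIV] \<in> Fl"
      by (auto simp: Fl_def is_flag_def)
    then show ?thesis
    proof cases
      case 1
      then show ?thesis
        using flat_empty[OF \<open>loopless\<close>] rk_indep[OF indep_empty] by (simp add: decoration_flat_def)
    next
      case 2
      then show ?thesis
        using flat_ground r by (simp add: decoration_flat_def)
    next
      case 3
      have len: "length (F [S, UNIV]) = length [S, UNIV]"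
        "\<forall>i<length [S, UNIV]. rk (F [S, UNIV] ! i) = card ([S, UNIV] ! i)"
        "\<forall>X\<in>set (F [S, UNIV]). flat X"
        using F 3 by (auto simp only: flag_decoration_def flags_of_flats_def)
      have "F [S, UNIV] ! 0 \<in> set (F [S, UNIV])"
        using len(1) by (intro nth_mem) simp
      then show ?thesis
        using len(2,3) decoration_nth[OF F 3, of 0] by force
    qed
  qed
  have mono: "decoration_flat F S \<subseteq> decoration_flat F T" if "S \<subseteq> T" for S T
  proof -
    have "[S, T, UNIV] \<in> Fl" if "S \<noteq> {}" "S \<noteq> T" "T \<noteq> UNIV"
      using that \<open>S \<subseteq> T\<close> by (simp add: Fl_def is_flag_def psubset_eq) blast
    then consider "S = {}" | "S = T" | "T = UNIV" | "[S, T, UNIV] \<in> Fl"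
      by blast
    then show ?thesis
    proof cases
      case 3
      then show ?thesis
        using val[of S] by (simp add: decoration_flat_def flat_def)
    next
      case 4
      have "sorted_wrt (\<subset>) (F [S, T, UNIV])" "length (F [S, T, UNIV]) = 3"
        using F 4 by (auto simp: flag_decoration_def flags_of_flats_def is_flag_def)
      then have "F [S, T, UNIV] ! 0 \<subset> F [S, T, UNIV] ! 1"
        by (simp add: sorted_wrt_iff_nth_less)
      then show ?thesis
        using decoration_nth[OF F 4, of 0] decoration_nth[OF F 4, of 1] by auto
    qed (auto simp: decoration_flat_def)
  qed
  show ?thesis
    using val mono by unfold_locales auto
qed

text \<open>The condition at index 0 reads \<open>{} = cl {}\<close>, which looplessness guarantees;
  the other indices run through the members of \<open>W\<close>.\<close>

lemma adapted_iff:
  fixes F :: "'n::finite set list \<Rightarrow> 'a set list"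
  assumes F: "flag_decoration F" and "loopless" and W: "full_flag W"
  shows "adapted F b W \<longleftrightarrow> (\<forall>S\<in>set W. decoration_flat F S = cl (b ` S))"
proof -
  have W': "W \<in> Fl" "length W = CARD('n)"
    using W by (auto simp: full_flag_def)
  have "cl {} = {}"
    using flat_empty[OF \<open>loopless\<close>] by (simp add: flat_def)
  moreover have "(\<forall>i\<le>n. P i) \<longleftrightarrow> P 0 \<and> (\<forall>i<n. P (Suc i))" for n and P :: "nat \<Rightarrow> bool"
    using All_less_Suc2[of n P] by (simp add: less_Suc_eq_le)
  ultimately have "adapted F b W \<longleftrightarrow> (\<forall>i<length W. F W ! i = cl (b ` (W ! i)))"
    unfolding adapted_def W'(2)[symmetric] by simp
  also have "\<dots> \<longleftrightarrow> (\<forall>S\<in>set W. decoration_flat F S = cl (b ` S))"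
    using decoration_nth[OF F W'(1)] by (simp add: all_set_conv_all_nth)
  finally show ?thesis .
qed

end

theorem theorem3p3:
  fixes E :: "'a set" and indep :: "'a set \<Rightarrow> bool"
    and F :: "'n::finite set list \<Rightarrow> 'a set list"
  assumes "matroid E indep"
    and "matroid.loopless E indep"
    and "matroid.rk indep E = CARD('n)"
    and "matroid.flag_decoration E indep F"
  shows "\<exists>\<Xi> :: (real ^ 'n) set set.
           complete_fan \<Xi> \<and> coarsens \<Xi> permutohedral_fan \<and>
           matroid.edge_collection E indep F =
             {(W, W') \<in> permutohedron_edges. merged_in \<Xi> (flag_cone W) (flag_cone W')}"
proof -
  interpret matroid E indep by fact
  interpret flat_family E indep "decoration_flat F"
    by (rule flat_family_decoration_flat[OF assms(4,2,3)])
  have "(\<exists>b. ordered_basis b \<and> adapted F b W \<and> adapted F b W') =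
      merged_in flag_fan (flag_cone W) (flag_cone W')"
    if "(W, W') \<in> permutohedron_edges" for W W'
  proof -
    from that have full: "full_flag W" "full_flag W'"
      by (auto simp: permutohedron_edges_def)
    show ?thesis
      unfolding merged_in_flag_fan_iff[OF full] adapted_iff[OF assms(4,2) full(1)]
        adapted_iff[OF assms(4,2) full(2)]
      by (rule common_basis_iff[OF assms(3) full])
  qed
  then have "edge_collection F =
      {(W, W') \<in> permutohedron_edges. merged_in flag_fan (flag_cone W) (flag_cone W')}"
    unfolding edge_collection_def by blast
  then show ?thesis
    using complete_fan_flag_fan coarsens_flag_fan by blast
qed

end
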